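(* Let $\overrightarrow{G}$ be an orientation of a graph $G$ of order $n$, and let $\det(xI-S(\overrightarrow{G}))=\sum_{i=0}^n b_i x^{n-i}$ be the characteristic polynomial of its skew adjacency matrix. Then $$\mathcal{E}_s(\overrightarrow{G})=\frac{1}{\pi}\int_{-\infty}^{\infty}\frac{1}{t^2}\ln\Bigl(1+\sum_{k=1}^{\lfloor n/2\rfloor} b_{2k}t^{2k}\Bigr)\,dt .$$
   Context: Graphs are finite, simple and undirected; an orientation $\overrightarrow{G}$ of $G$ assigns a direction to each edge. The skew adjacency matrix $S(\overrightarrow{G})=(s_{i,j})$ has $s_{i,j}=1$, $s_{j,i}=-1$ if $i\to j$ is an arc, and $s_{i,j}=s_{j,i}=0$ if $i,j$ are non-adjacent. The skew energy is $\mathcal{E}_s(\overrightarrow{G})=\sum_{i=1}^n|\lambda_i|$, where $\lambda_1,\dots,\lambda_n$ are the eigenvalues of $S(\overrightarrow{G})$ with multiplicity. *)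

theory Defs
  imports
    "HOL-Analysis.Analysis"
    "Graph_Theory.Pair_Digraph"
    "Jordan_Normal_Form.Spectral_Radius"
begin

text \<open>
  A finite simple undirected graph is a \<open>pair_graph\<close>: each edge \<open>{u, v}\<close> is
  represented by the two arcs \<open>(u, v)\<close> and \<open>(v, u)\<close>, and an orientation keeps
  exactly one of them.
\<close>

definition orientation_of :: "'a pair_pre_digraph \<Rightarrow> 'a pair_pre_digraph \<Rightarrow> bool" where
  "orientation_of D G \<longleftrightarrow>
     pverts D = pverts G \<and> parcs D \<subseteq> parcs G \<and>
     (\<forall>(u, v) \<in> parcs G. (u, v) \<in> parcs D \<longleftrightarrow> (v, u) \<notin> parcs D)"

text \<open>
  The rows and columns are indexed along a labelling \<open>w 0, \<dots>, w (n - 1)\<close> of the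
  \<open>n\<close> vertices, meant to be a bijection from \<open>{..<n}\<close> onto \<open>pverts D\<close>.
\<close>

definition skew_adjacency_mat :: "'a pair_pre_digraph \<Rightarrow> (nat \<Rightarrow> 'a) \<Rightarrow> real mat" where
  "skew_adjacency_mat D w =
     Matrix.mat (card (pverts D)) (card (pverts D)) (\<lambda>(i, j).
       if (w i, w j) \<in> parcs D then 1
       else if (w j, w i) \<in> parcs D then -1
       else 0)"

text \<open>
  The eigenvalues are complex (in fact purely imaginary), and each is counted with its
  multiplicity as a root of the characteristic polynomial.
\<close>

definition skew_energy :: "'a pair_pre_digraph \<Rightarrow> (nat \<Rightarrow> 'a) \<Rightarrow> real" where
  "skew_energy D w =
     (let S = map_mat complex_of_real (skew_adjacency_mat D w)
      in \<Sum>\<mu> \<in> spectrum S. real (Polynomial.order \<mu> (char_poly S)) * cmod \<mu>)"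

end

theory Submission
  imports Defs "HOL-Probability.Distributions" "HOL-Real_Asymp.Real_Asymp"
begin

text \<open>
  A real skew-symmetric matrix has purely imaginary eigenvalues \<open>\<mu>\<close>, so the reversed
  characteristic polynomial \<open>q t = \<Prod>(1 - \<mu> t)\<close> satisfies \<open>q (- t) = cnj (q t) = q t\<close> for real
  \<open>t\<close>. Hence \<open>q\<close> equals its even part, which is the argument of the logarithm. It has no real
  zero and \<open>q 0 = 1\<close>, so it is positive, and \<open>ln (q t) = 1/2 \<Sum> ln (1 + (\<bar>\<mu>\<bar> t)\<^sup>2)\<close>. Each
  summand divided by \<open>t\<^sup>2\<close> integrates to \<open>2 \<pi> \<bar>\<mu>\<bar>\<close>, by the antiderivative
  \<open>2 a arctan (a t) - ln (1 + (a t)\<^sup>2) / t\<close>.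
\<close>

lemma has_bochner_integral_ln_one_plus_square:
  fixes a :: real
  shows "has_bochner_integral lborel (\<lambda>t. ln (1 + (a * t)\<^sup>2) / t\<^sup>2) (2 * pi * \<bar>a\<bar>)"
proof -
  \<comment> \<open>The integrand depends only on \<open>a\<^sup>2\<close>. Passing to the absolute
    value makes \<open>c\<close> positive in the main case, which fixes the sign of the arctan limit
    at infinity.\<close>
  define c where "c = \<bar>a\<bar>"
  let ?f = "\<lambda>t. ln (1 + (c * t)\<^sup>2) / t\<^sup>2"
  let ?F = "\<lambda>t. 2 * c * arctan (c * t) - ln (1 + (c * t)\<^sup>2) / t"
  have ca: "(c * t)\<^sup>2 = (a * t)\<^sup>2" for t
    by (simp add: c_def power_mult_distrib)
  have "has_bochner_integral lborel ?f (2 * pi * c)"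
  proof (cases "c = 0")
    case False
    then have c: "c > 0" by (simp add: c_def)
    have pos: "1 + (c * t)\<^sup>2 > 0" for t
      by (simp add: add_pos_nonneg)
    have deriv: "DERIV ?F t :> ?f t" if "0 < t" for t
    proof -
      have "DERIV (\<lambda>t. 1 + (c * t)\<^sup>2) t :> 2 * (c * t) * c"
        by (auto intro!: derivative_eq_intros)
      from DERIV_chain2[OF DERIV_ln_divide[OF pos] this]
      have "DERIV (\<lambda>t. ln (1 + (c * t)\<^sup>2)) t :> 2 * (c * t) * c / (1 + (c * t)\<^sup>2)"
        by simp
      moreover have "DERIV (\<lambda>t. arctan (c * t)) t :> c / (1 + (c * t)\<^sup>2)"
        by (auto intro!: derivative_eq_intros simp: divide_inverse)
      ultimately have D: "DERIV ?F t :> 2 * c * (c / (1 + (c * t)\<^sup>2))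
          - ((2 * (c * t) * c / (1 + (c * t)\<^sup>2)) * t - ln (1 + (c * t)\<^sup>2) * 1) / (t * t)"
        using that by (intro DERIV_diff DERIV_cmult DERIV_divide DERIV_ident) auto
      \<comment> \<open>The arctan derivative cancels the part of the quotient rule that
        differentiates the logarithm, leaving the logarithm over \<open>t\<^sup>2\<close>.\<close>
      show ?thesis
        by (rule DERIV_cong[OF D]) (use that in \<open>simp add: diff_divide_distrib power2_eq_square\<close>)
    qed
    have nonneg: "AE x in lborel. 0 < ereal x \<longrightarrow> ereal x < \<infinity> \<longrightarrow> 0 \<le> ?f x"
      by (intro AE_I2) simp
    have cont: "isCont ?f t" if "0 < t" for t
      using that pos[of t] by (intro continuous_intros) auto
    \<comment> \<open>Near 0 the quotient in \<open>?F\<close> behaves like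
      \<open>c\<^sup>2 * t\<close>. At infinity it vanishes and arctan tends to
      \<open>pi / 2\<close>.\<close>
    have lim0: "((?F \<circ> real_of_ereal) \<longlongrightarrow> 0) (at_right 0)"
      unfolding zero_ereal_def ereal_tendsto_simps using c by real_asymp
    have lim_infty: "((?F \<circ> real_of_ereal) \<longlongrightarrow> pi * c) (at_left \<infinity>)"
      unfolding ereal_tendsto_simps using c by real_asymp
    \<comment> \<open>For a nonnegative integrand, finite limits of the antiderivative at both ends
      give integrability together with the value.\<close>
    note ftc = interval_integral_FTC_nonneg[of 0 \<infinity> ?F ?f, OF _ _ _ nonneg lim0 lim_infty]
    have "set_integrable lborel {0<..} ?f" "(LBINT t:{0<..}. ?f t) = pi * c"
      using ftc deriv cont
      by (simp_all add: interval_lebesgue_integral_def zero_ereal_def)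
    then have "has_bochner_integral lborel (\<lambda>t. indicator {0<..} t *\<^sub>R ?f t) (pi * c)"
      by (simp add: has_bochner_integral_iff set_integrable_def set_lebesgue_integral_def)
    \<comment> \<open>the integrand vanishes at \<open>0\<close> because division by zero gives \<open>0\<close>\<close>
    also have "(\<lambda>t. indicator {0<..} t *\<^sub>R ?f t) = (\<lambda>t. indicator {0..} t *\<^sub>R ?f t)"
      by (auto simp: fun_eq_iff indicator_def)
    finally have "has_bochner_integral lborel ?f (2 *\<^sub>R (pi * c))"
      by (rule has_bochner_integral_even_function) simp
    then show ?thesis by (simp add: mult_ac)
  qed (simp add: has_bochner_integral_zero)
  then show ?thesis
    unfolding ca by (simp add: c_def)
qed

text \<open>For an eigenvector \<open>v\<close>, the form \<open>Q\<close> (conjugate transpose of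
  \<open>v\<close>, times \<open>A v\<close>) equals \<open>\<mu> * N\<close>, where
  \<open>N\<close> is the squared norm of \<open>v\<close>, real and nonzero. As \<open>A\<close> is
  real and skew, conjugation negates \<open>Q\<close>, so
  \<open>cnj \<mu> = - \<mu>\<close>.\<close>

lemma Re_eigenvalue_skew_mat:
  fixes A :: "real mat"
  assumes A: "A \<in> carrier_mat n n"
    and skew: "\<And>i j. i < n \<Longrightarrow> j < n \<Longrightarrow> A $$ (j, i) = - A $$ (i, j)"
    and ev: "eigenvalue (map_mat complex_of_real A) \<mu>"
  shows "Re \<mu> = 0"
proof -
  obtain v where v: "v \<in> carrier_vec n" "v \<noteq> 0\<^sub>v n"
    and Av: "map_mat complex_of_real A *\<^sub>v v = \<mu> \<cdot>\<^sub>v v"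
    using ev A by (auto simp: eigenvalue_def eigenvector_def)
  have row: "(\<Sum>j<n. of_real (A $$ (i, j)) * v $ j) = \<mu> * v $ i" if "i < n" for i
    using arg_cong[OF Av, of "\<lambda>u. u $ i"] that A v
    by (simp add: scalar_prod_def lessThan_atLeast0)
  define N where "N = (\<Sum>i<n. v $ i * cnj (v $ i))"
  define Q where "Q = (\<Sum>i<n. \<Sum>j<n. cnj (v $ i) * of_real (A $$ (i, j)) * v $ j)"
  have Q: "Q = \<mu> * N"
    unfolding Q_def N_def sum_distrib_left
    by (intro sum.cong refl) (simp add: row mult.assoc mult.left_commute flip: sum_distrib_left)
  have N_real: "N = of_real (\<Sum>i<n. (cmod (v $ i))\<^sup>2)"
    by (simp only: N_def of_real_sum complex_norm_square)
  have swap: "v $ i * of_real (A $$ (i, j)) * cnj (v $ j)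
      = - (cnj (v $ j) * of_real (A $$ (j, i)) * v $ i)" if "i < n" "j < n" for i j
    using skew[OF that] by simp
  have "cnj Q = (\<Sum>i<n. \<Sum>j<n. v $ i * of_real (A $$ (i, j)) * cnj (v $ j))"
    by (simp add: Q_def)
  also have "\<dots> = (\<Sum>j<n. \<Sum>i<n. v $ i * of_real (A $$ (i, j)) * cnj (v $ j))"
    by (rule sum.swap)
  also have "\<dots> = - Q"
    unfolding Q_def sum_negf[symmetric] by (intro sum.cong refl) (simp add: swap)
  finally have "cnj \<mu> * cnj N = - \<mu> * N"
    by (simp add: Q)
  then have "cnj \<mu> * N = - \<mu> * N"
    by (simp only: N_real complex_cnj_complex_of_real)
  moreover have "N \<noteq> 0"
  proof
    assume "N = 0"
    then have "(\<Sum>i<n. (cmod (v $ i))\<^sup>2) = 0"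
      by (simp only: N_real of_real_eq_0_iff)
    then have "v = 0\<^sub>v n"
      using v(1) by (intro eq_vecI) (auto simp: sum_nonneg_eq_0_iff)
    with v(2) show False by simp
  qed
  ultimately have "cnj \<mu> = - \<mu>"
    by (metis mult_cancel_right)
  then show ?thesis
    by (simp add: complex_eq_iff)
qed

text \<open>Reversal is multiplicative and turns each linear factor X - z into 1 - z X; a zero root
  just contributes the factor 1.\<close>

lemma poly_reflect_poly_roots:
  fixes p :: "complex poly"
  assumes "lead_coeff p = 1"
  shows "poly (reflect_poly p) x = (\<Prod>z | poly p z = 0. (1 - z * x) ^ Polynomial.order z p)"
proof -
  have lin: "reflect_poly [:- z, 1:] = [:1, - z:]" for z :: complex
    by (simp add: reflect_poly_def cCons_def)
  have "p = (\<Prod>z | poly p z = 0. [:- z, 1:] ^ Polynomial.order z p)"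
    using complex_poly_decompose[of p] assms by simp
  then have "reflect_poly p
      = reflect_poly (\<Prod>z | poly p z = 0. [:- z, 1:] ^ Polynomial.order z p)"
    by (rule arg_cong)
  then show ?thesis
    by (simp add: reflect_poly_prod reflect_poly_power lin poly_prod mult.commute)
qed

text \<open>Odd powers cancel between \<open>t\<close> and \<open>- t\<close>. An even polynomial
  can thus be exchanged for the sum of its even-degree terms.\<close>

lemma sum_even_part:
  fixes b :: "nat \<Rightarrow> real"
  shows "(\<Sum>k = 0..n div 2. b (2 * k) * t ^ (2 * k))
    = ((\<Sum>i\<le>n. b i * t ^ i) + (\<Sum>i\<le>n. b i * (- t) ^ i)) / 2"
proof -
  have "(\<Sum>k = 0..n div 2. b (2 * k) * t ^ (2 * k)) = (\<Sum>i | i \<le> n \<and> even i. b i * t ^ i)"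
    by (rule sum.reindex_bij_witness[of _ "\<lambda>i. i div 2" "\<lambda>k. 2 * k"]) auto
  also have "\<dots> = (\<Sum>i\<le>n. if even i then b i * t ^ i else 0)"
    by (simp add: sum.If_cases Collect_conj_eq atMost_def)
  also have "\<dots> = (\<Sum>i\<le>n. (b i * t ^ i + b i * (- t) ^ i) / 2)"
    by (intro sum.cong) auto
  finally show ?thesis
    by (simp add: sum.distrib flip: sum_divide_distrib)
qed

lemma ln_rev_char_poly_skew_mat:
  fixes A :: "real mat"
  assumes A: "A \<in> carrier_mat n n"
    and skew: "\<And>i j. i < n \<Longrightarrow> j < n \<Longrightarrow> A $$ (j, i) = - A $$ (i, j)"
    and b: "char_poly A = (\<Sum>i = 0..n. Polynomial.monom (b i) (n - i))"
  defines "S \<equiv> map_mat complex_of_real A"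
  shows "ln (1 + (\<Sum>k = 1..n div 2. b (2 * k) * t ^ (2 * k)))
    = (\<Sum>\<mu>\<in>spectrum S. real (Polynomial.order \<mu> (char_poly S)) / 2 * ln (1 + (cmod \<mu> * t)\<^sup>2))"
proof -
  let ?p = "char_poly S"
  define q where "q t = (\<Sum>i\<le>n. b i * t ^ i)" for t
  have S: "S \<in> carrier_mat n n"
    using A by (simp add: S_def)
  have deg: "degree ?p = n" and monic: "lead_coeff ?p = 1"
    using degree_monic_char_poly[OF S] by auto
  have p: "?p = map_poly of_real (char_poly A)"
    unfolding S_def by (rule of_real_hom.char_poly_hom[OF A])
  \<comment> \<open>Subtraction on nat truncates: \<open>n - j = n - i\<close> forces
    \<open>j = i\<close> because both indices are at most \<open>n\<close>.\<close>
  have b_coeff: "coeff (char_poly A) (n - i) = b i" if "i \<le> n" for i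
  proof -
    have "coeff (char_poly A) (n - i) = (\<Sum>j = 0..n. if n - j = n - i then b j else 0)"
      by (simp add: b coeff_sum)
    also have "\<dots> = (\<Sum>j = 0..n. if j = i then b j else 0)"
      by (rule sum.cong[OF refl], rule if_cong) (use that in auto)
    finally show ?thesis using that by simp
  qed
  have coeff_p: "coeff ?p (n - i) = of_real (b i)" if "i \<le> n" for i
    using that by (simp add: p coeff_map_poly b_coeff)
  have spec: "spectrum S = {z. poly ?p z = 0}"
    using eigenvalue_root_char_poly[OF S] by (auto simp: spectrum_def)
  have imag: "Re \<mu> = 0" if "\<mu> \<in> spectrum S" for \<mu>
    using that Re_eigenvalue_skew_mat[OF A skew] by (simp add: S_def spectrum_def)
  have q: "of_real (q t) = (\<Prod>\<mu>\<in>spectrum S. (1 - \<mu> * of_real t) ^ Polynomial.order \<mu> ?p)" for t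
  proof -
    have "poly (reflect_poly ?p) (of_real t)
        = (\<Sum>i\<le>n. coeff (reflect_poly ?p) i * of_real t ^ i)"
      \<comment> \<open>The reversed polynomial has degree below \<open>n\<close> when 0 is an
        eigenvalue, so the sum is padded with zero coefficients up to \<open>n\<close>.\<close>
      unfolding poly_altdef using degree_reflect_poly_le[of ?p] deg
      by (intro sum.mono_neutral_left) (auto simp: coeff_eq_0)
    also have "\<dots> = of_real (q t)"
      by (simp add: q_def coeff_reflect_poly deg coeff_p)
    finally show ?thesis
      using poly_reflect_poly_roots[OF monic, of "of_real t"] by (simp add: spec)
  qed
  \<comment> \<open>Since \<open>\<mu>\<close> is purely imaginary, 1 and
    \<open>\<mu> * of_real t\<close> are orthogonal in the complex plane.\<close>
  have norm_factor: "cmod (1 - \<mu> * of_real t) = sqrt (1 + (cmod \<mu> * t)\<^sup>2)"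
    if "\<mu> \<in> spectrum S" for \<mu> t
    using imag[OF that] by (simp add: cmod_def power_mult_distrib)
  have abs_q: "\<bar>q t\<bar> = (\<Prod>\<mu>\<in>spectrum S. sqrt (1 + (cmod \<mu> * t)\<^sup>2) ^ Polynomial.order \<mu> ?p)"
    for t
    using arg_cong[OF q[of t], of cmod] by (simp add: norm_factor prod_norm[symmetric] norm_power)
  have one_plus: "1 + x\<^sup>2 > (0 :: real)" for x
    by (simp add: add_pos_nonneg)
  have q_nz: "q t \<noteq> 0" for t
  proof -
    have "\<bar>q t\<bar> > 0"
      unfolding abs_q by (intro prod_pos zero_less_power) (simp add: one_plus)
    then show ?thesis by simp
  qed
  have q_even: "q (- t) = q t" for t
  proof -
    \<comment> \<open>Conjugating a single factor 1 - \<mu> t already gives the same factor at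
      -t.\<close>
    have "cnj \<mu> = - \<mu>" if "\<mu> \<in> spectrum S" for \<mu>
      using imag[OF that] by (simp add: complex_eq_iff)
    then have "complex_of_real (q (- t)) = cnj (of_real (q t))"
      unfolding q cnj_prod by (intro prod.cong refl) simp
    then show ?thesis by simp
  qed
  have b0: "b 0 = 1"
    using degree_monic_char_poly[OF A] b_coeff[of 0] by simp
  \<comment> \<open>The product formula for the modulus loses the sign of \<open>q\<close>;
    connectedness of its range recovers it from \<open>q 0 = 1\<close>.\<close>
  have q_pos: "q t > 0" for t
  proof (rule ccontr)
    assume "\<not> q t > 0"
    then have "q t \<le> 0" by simp
    moreover have "q 0 > 0"
      by (simp add: q_def b0 power_0_left if_distrib sum.delta cong: if_cong)
    moreover have "connected (range q)"
      by (intro connected_continuous_image) (auto simp: q_def intro!: continuous_intros)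
    ultimately have "0 \<in> range q"
      using connectedD_interval[of "range q" "q t" "q 0" 0] by auto
    then show False using q_nz by auto
  qed
  have "1 + (\<Sum>k = 1..n div 2. b (2 * k) * t ^ (2 * k))
      = (\<Sum>k = 0..n div 2. b (2 * k) * t ^ (2 * k))"
    by (simp add: sum.atLeast_Suc_atMost[of 0] b0)
  also have "\<dots> = q t"
    unfolding sum_even_part using q_even[of t] by (simp add: q_def)
  also have "q t = (\<Prod>\<mu>\<in>spectrum S. sqrt (1 + (cmod \<mu> * t)\<^sup>2) ^ Polynomial.order \<mu> ?p)"
    using abs_q[of t] q_pos[of t] by simp
  also have "ln \<dots>
      = (\<Sum>\<mu>\<in>spectrum S. ln (sqrt (1 + (cmod \<mu> * t)\<^sup>2) ^ Polynomial.order \<mu> ?p))"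
    by (rule ln_prod) (simp_all add: card_finite_spectrum[OF S] less_imp_neq[OF one_plus, symmetric])
  also have "\<dots> = (\<Sum>\<mu>\<in>spectrum S. real (Polynomial.order \<mu> ?p) / 2 * ln (1 + (cmod \<mu> * t)\<^sup>2))"
    by (intro sum.cong refl) (simp add: ln_realpow ln_sqrt one_plus)
  finally show ?thesis .
qed

lemma skew_adjacency_mat_skew:
  assumes D: "orientation_of D G" and n: "n = card (pverts G)" and ij: "i < n" "j < n"
  shows "skew_adjacency_mat D w $$ (j, i) = - skew_adjacency_mat D w $$ (i, j)"
proof -
  \<comment> \<open>With equal endpoints this also excludes loops, so the diagonal entries are 0 and
    the case \<open>i = j\<close> is covered.\<close>
  have "\<not> ((w i, w j) \<in> parcs D \<and> (w j, w i) \<in> parcs D)"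
    using D unfolding orientation_of_def by blast
  moreover have "card (pverts D) = n"
    using D n by (simp add: orientation_of_def)
  ultimately show ?thesis
    using ij by (auto simp: skew_adjacency_mat_def)
qed

theorem theorem2p6:
  fixes G D :: "'a pair_pre_digraph" and w :: "nat \<Rightarrow> 'a"
    and n :: nat and b :: "nat \<Rightarrow> real"
  assumes "pair_graph G"
    and "orientation_of D G"
    and "n = card (pverts G)"
    and "bij_betw w {..<n} (pverts G)"
    and "char_poly (skew_adjacency_mat D w) = (\<Sum>i = 0..n. Polynomial.monom (b i) (n - i))"
  shows "interval_lebesgue_integrable lborel (-\<infinity>) \<infinity>
           (\<lambda>t. 1 / t ^ 2 * ln (1 + (\<Sum>k = 1..n div 2. b (2 * k) * t ^ (2 * k))))
         \<and> skew_energy D w =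
           1 / pi * (LBINT t=-\<infinity>..\<infinity>.
             1 / t ^ 2 * ln (1 + (\<Sum>k = 1..n div 2. b (2 * k) * t ^ (2 * k))))"
proof -
  let ?A = "skew_adjacency_mat D w"
  let ?f = "\<lambda>t. 1 / t ^ 2 * ln (1 + (\<Sum>k = 1..n div 2. b (2 * k) * t ^ (2 * k)))"
  define S where "S = map_mat complex_of_real ?A"
  define m where "m \<mu> = real (Polynomial.order \<mu> (char_poly S))" for \<mu>
  have A: "?A \<in> carrier_mat n n"
    using assms(2,3) by (simp add: skew_adjacency_mat_def orientation_of_def)
  have skew: "?A $$ (j, i) = - ?A $$ (i, j)" if "i < n" "j < n" for i j
    using skew_adjacency_mat_skew assms(2,3) that by blast
  have "?f t = (\<Sum>\<mu>\<in>spectrum S. m \<mu> / 2 * (ln (1 + (cmod \<mu> * t)\<^sup>2) / t\<^sup>2))" for t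
  proof -
    have "ln (1 + (\<Sum>k = 1..n div 2. b (2 * k) * t ^ (2 * k)))
        = (\<Sum>\<mu>\<in>spectrum S. m \<mu> / 2 * ln (1 + (cmod \<mu> * t)\<^sup>2))"
      unfolding m_def S_def by (rule ln_rev_char_poly_skew_mat[OF A skew assms(5)])
    then show ?thesis
      by (simp add: sum_divide_distrib)
  qed
  moreover have "has_bochner_integral lborel
      (\<lambda>t. \<Sum>\<mu>\<in>spectrum S. m \<mu> / 2 * (ln (1 + (cmod \<mu> * t)\<^sup>2) / t\<^sup>2))
      (\<Sum>\<mu>\<in>spectrum S. m \<mu> / 2 * (2 * pi * \<bar>cmod \<mu>\<bar>))"
    by (intro has_bochner_integral_sum has_bochner_integral_mult_right
        has_bochner_integral_ln_one_plus_square)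
  \<comment> \<open>The 1/2 from the square root in the modulus cancels the 2 from integrating over
    both half-lines.\<close>
  moreover have "(\<Sum>\<mu>\<in>spectrum S. m \<mu> / 2 * (2 * pi * \<bar>cmod \<mu>\<bar>)) = pi * skew_energy D w"
    by (simp add: skew_energy_def Let_def S_def m_def sum_distrib_left mult_ac)
  ultimately have "has_bochner_integral lborel ?f (pi * skew_energy D w)"
    by simp
  then show ?thesis
    by (simp add: has_bochner_integral_iff interval_lebesgue_integrable_def
        interval_lebesgue_integral_def set_integrable_def set_lebesgue_integral_def)
qed

end
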